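(* Let $\mathbb{F}=\mathbb{F}_q$ be a finite field with $q$ elements and let $m\ge1$. Then: (a) the number of $\mathrm{GL}_2(\mathbb{F})$-orbits on $\mathcal{N}_2^m$ is equal to $$\kappa=1+\frac{(q^m-1)(q^{m-1}+q)}{q^2-1};$$ (b) $\kappa$ has the following presentation as a polynomial in $q$ with integer non-negative coefficients: $$\kappa=\kappa(q)=\begin{cases}1+S_{m-1}(q)+(q^{m-1}-1)\,S_{\frac{m-2}{2}}(q^2),&\text{if } m\text{ is even},\\ 1+S_{m-1}(q)+(q^m-1)\,S_{\frac{m-3}{2}}(q^2),&\text{if } m\text{ is odd};\end{cases}$$ (c) the least possible number of elements of a separating set for $\mathcal{O}(\mathcal{N}_2^m)^{\mathrm{GL}_2}$ is $$\gamma=\begin{cases}1,&\text{if } m=1,\\3,&\text{if } m=q=2,\\2m-2,&\text{otherwise}.\end{cases}$$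
   Context: $\mathcal{N}_2$ is the set of all nilpotent $2\times2$ matrices over $\mathbb{F}$. The group $\mathrm{GL}_2=\mathrm{GL}_2(\mathbb{F})$ acts on $\mathcal{N}_2^m$ by simultaneous conjugation: $g\cdot(A_1,\ldots,A_m)=(gA_1g^{-1},\ldots,gA_mg^{-1})$. For an integer $k$, $S_k(q)=q^k+q^{k-1}+\cdots+1=\frac{q^{k+1}-1}{q-1}$ if $k\ge0$, and $S_k(q)=0$ if $k<0$; $S_k(q^2)$ denotes the same expression with $q$ replaced by $q^2$. $\mathcal{O}(\mathcal{N}_2^m)$ is the $\mathbb{F}$-algebra of functions $\mathcal{N}_2^m\to\mathbb{F}$ generated by the entry functions $y_{ij}(k):(A_1,\ldots,A_m)\mapsto(A_k)_{ij}$ ($1\le i,j\le2$, $1\le k\le m$), and $\mathcal{O}(\mathcal{N}_2^m)^{\mathrm{GL}_2}$ is the subalgebra of functions constant on $\mathrm{GL}_2$-orbits. Two points are separated by a set $S$ of invariant functions if some $f\in S$ takes different values at them; $S\subset\mathcal{O}(\mathcal{N}_2^m)^{\mathrm{GL}_2}$ is separating if any two points separated by $\mathcal{O}(\mathcal{N}_2^m)^{\mathrm{GL}_2}$ are separated by $S$. *)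

theory Defs
  imports "HOL-Analysis.Determinants" "HOL-Computational_Algebra.Polynomial" "HOL-Library.FuncSet"
begin

(* (^) on 'a^'n^'n is the componentwise power; the matrix power is written as an iterate of left multiplication by A. *)
definition mat_nilpotent :: "'a::field^'n^'n \<Rightarrow> bool" where
  "mat_nilpotent A \<longleftrightarrow> (\<exists>n. ((**) A ^^ n) (mat 1) = 0)"

(* An m-tuple of matrices is a function on {1..m}, extended by undefined outside {1..m}. *)
definition nil_tuples :: "nat \<Rightarrow> (nat \<Rightarrow> 'a::field^2^2) set" where
  "nil_tuples m = (\<Pi>\<^sub>E k\<in>{1..m}. {A. mat_nilpotent A})"

definition conj_act :: "nat \<Rightarrow> 'a::field^2^2 \<Rightarrow> (nat \<Rightarrow> 'a^2^2) \<Rightarrow> (nat \<Rightarrow> 'a^2^2)" where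
  "conj_act m g A = (\<lambda>k\<in>{1..m}. g ** A k ** matrix_inv g)"

definition GL2_orbit :: "nat \<Rightarrow> (nat \<Rightarrow> 'a::field^2^2) \<Rightarrow> (nat \<Rightarrow> 'a^2^2) set" where
  "GL2_orbit m A = {conj_act m g A |g. invertible g}"

definition GL2_orbits :: "nat \<Rightarrow> (nat \<Rightarrow> 'a::field^2^2) set set" where
  "GL2_orbits m = GL2_orbit m ` nil_tuples m"

(* Functions on nil_tuples m are extended by undefined, so that equality of elements of
   coord_ring m is equality of functions on nil_tuples m. *)
inductive_set coord_ring :: "nat \<Rightarrow> ((nat \<Rightarrow> 'a::field^2^2) \<Rightarrow> 'a) set" for m :: nat where
  const: "(\<lambda>A\<in>nil_tuples m. c) \<in> coord_ring m"
| entry: "k \<in> {1..m} \<Longrightarrow> (\<lambda>A\<in>nil_tuples m. A k $ i $ j) \<in> coord_ring m"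
| add: "f \<in> coord_ring m \<Longrightarrow> h \<in> coord_ring m \<Longrightarrow> (\<lambda>A\<in>nil_tuples m. f A + h A) \<in> coord_ring m"
| mult: "f \<in> coord_ring m \<Longrightarrow> h \<in> coord_ring m \<Longrightarrow> (\<lambda>A\<in>nil_tuples m. f A * h A) \<in> coord_ring m"

definition invariant_ring :: "nat \<Rightarrow> ((nat \<Rightarrow> 'a::field^2^2) \<Rightarrow> 'a) set" where
  "invariant_ring m = {f \<in> coord_ring m. \<forall>A\<in>nil_tuples m. \<forall>B\<in>GL2_orbit m A. f B = f A}"

definition separated_by :: "('p \<Rightarrow> 'a) set \<Rightarrow> 'p \<Rightarrow> 'p \<Rightarrow> bool" where
  "separated_by S A B \<longleftrightarrow> (\<exists>f\<in>S. f A \<noteq> f B)"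

definition separating_set :: "nat \<Rightarrow> ((nat \<Rightarrow> 'a::field^2^2) \<Rightarrow> 'a) set \<Rightarrow> bool" where
  "separating_set m S \<longleftrightarrow> S \<subseteq> invariant_ring m \<and>
     (\<forall>A\<in>nil_tuples m. \<forall>B\<in>nil_tuples m.
        separated_by (invariant_ring m) A B \<longrightarrow> separated_by S A B)"

definition geom_S :: "int \<Rightarrow> 'r::comm_ring_1 \<Rightarrow> 'r" where
  "geom_S k x = (if k < 0 then 0 else (\<Sum>i\<le>nat k. x ^ i))"

(* Polymorphic, so that it can be evaluated both at a number and at the indeterminate of a
   polynomial ring. The divisions by 2 are exact in their branches; for m = 1 the last index is -1. *)
definition kappa_expr :: "nat \<Rightarrow> 'r::comm_ring_1 \<Rightarrow> 'r" where
  "kappa_expr m x =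
     (if even m
      then 1 + geom_S (int m - 1) x + (x ^ (m - 1) - 1) * geom_S ((int m - 2) div 2) (x\<^sup>2)
      else 1 + geom_S (int m - 1) x + (x ^ m - 1) * geom_S ((int m - 3) div 2) (x\<^sup>2))"

end

theory Submission
  imports Defs "HOL-Algebra.Group_Action"
begin

text \<open>
  Orbits are counted with Burnside's lemma. The fixed points of an invertible \<open>g\<close> on tuples are the
  tuples of nilpotent matrices commuting with \<open>g\<close>, so \<open>g\<close> fixes \<open>c ^ m\<close> tuples, where \<open>c\<close> is the
  number of nilpotent matrices commuting with \<open>g\<close>. A matrix commuting with a nonzero nilpotent \<open>N\<close> is of the form
  \<open>s + t N\<close>. Hence \<open>c = q\<^sup>2\<close> if \<open>g\<close> is scalar, \<open>c = q\<close> if \<open>g\<close> is a nonzero scalar plus a nonzero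
  nilpotent matrix, and \<open>c = 1\<close> otherwise.

  Over a finite field every function on tuples is polynomial in the entries, so the invariant ring
  consists of all functions that are constant on orbits. A separating set of size \<open>n\<close> therefore exists
  iff the orbits inject into \<open>n\<close>-tuples of field elements, and \<open>\<gamma>\<close> is the least \<open>n\<close> with
  \<open>\<kappa> \<le> q ^ n\<close>.
\<close>

section \<open>Nilpotent matrices of size two\<close>

lemma mat2_eq_iff:
  "(A :: 'a^2^2) = B \<longleftrightarrow>
     A$1$1 = B$1$1 \<and> A$1$2 = B$1$2 \<and> A$2$1 = B$2$1 \<and> A$2$2 = B$2$2"
  by (auto simp: vec_eq_iff forall_2)

lemma mat2_mult_nth:
  "((A :: 'a::semiring_1^2^2) ** B) $ i $ j = A$i$1 * B$1$j + A$i$2 * B$2$j"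
  by (simp add: matrix_matrix_mult_def sum_2)

lemma mat2_mat_nth:
  "(mat s :: 'a::zero^2^2) $ 1 $ 1 = s" "(mat s :: 'a::zero^2^2) $ 1 $ 2 = 0"
  "(mat s :: 'a::zero^2^2) $ 2 $ 1 = 0" "(mat s :: 'a::zero^2^2) $ 2 $ 2 = s"
  by (auto simp: mat_def)

lemmas mat2_simps = mat2_eq_iff mat2_mult_nth mat2_mat_nth

text \<open>Coordinates by quadruples, so that sets of matrices can be counted as injective images
  of products of sets of scalars.\<close>

definition mat2 :: "'a \<times> 'a \<times> 'a \<times> 'a \<Rightarrow> 'a::zero^2^2" where
  "mat2 = (\<lambda>(a, b, c, d). vector [vector [a, b], vector [c, d]])"

lemma mat2_nth [simp]:
  "mat2 (a, b, c, d) $ 1 $ 1 = a" "mat2 (a, b, c, d) $ 1 $ 2 = b"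
  "mat2 (a, b, c, d) $ 2 $ 1 = c" "mat2 (a, b, c, d) $ 2 $ 2 = d"
  by (simp_all add: mat2_def)

lemma bij_mat2: "bij mat2"
proof (rule bijI)
  show "inj mat2"
    by (auto simp: inj_on_def mat2_eq_iff)
  show "surj mat2"
    by (rule surjI[where f = "\<lambda>A. (A$1$1, A$1$2, A$2$1, A$2$2)"]) (simp add: mat2_eq_iff)
qed

lemma card_mat2_Collect: "card {A. P A} = card {x. P (mat2 x)}"
proof -
  have "{A. P A} = mat2 ` {x. P (mat2 x)}"
    using bij_mat2 by (auto simp: bij_def image_iff)
  then show ?thesis
    using bij_mat2 by (metis bij_def card_image inj_on_subset subset_UNIV)
qed

text \<open>The right-hand side says that trace and determinant vanish. Nilpotency kills the
  determinant, so Cayley-Hamilton reads A^2 = tA with t the trace; then A^(k+1) = t^k A, which can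
  vanish only if t = 0. Conversely the two equations give A^2 = 0.\<close>

lemma mat_nilpotent_iff:
  fixes A :: "'a::field^2^2"
  shows "mat_nilpotent A \<longleftrightarrow> A$2$2 = - A$1$1 \<and> A$1$1 * A$1$1 + A$1$2 * A$2$1 = 0"
proof
  assume "mat_nilpotent A"
  then obtain n where n: "((**) A ^^ n) (mat 1) = 0"
    by (auto simp: mat_nilpotent_def)
  have "det (((**) A ^^ n) (mat 1)) = det A ^ n" for n
    by (induction n) (auto simp: det_mul)
  from this[of n] n have d0: "det A ^ n = 0"
    by (simp add: det_2)
  then have d: "A$1$1 * A$2$2 = A$1$2 * A$2$1" and "n > 0"
    by (auto simp: det_2 intro: gr0I)
  define t where "t = A$1$1 + A$2$2"
  have "((**) A ^^ Suc k) (mat 1) = mat (t ^ k) ** A" for k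
  proof (induction k)
    case (Suc k)
    have "A ** (mat (t ^ k) ** A) = mat (t ^ Suc k) ** A"
      using d by (auto simp: mat2_simps t_def algebra_simps)
    then show ?case
      using Suc by simp
  qed (simp add: mat2_simps)
  from this[of "n - 1"] n \<open>n > 0\<close> have "mat (t ^ (n - 1)) ** A = 0"
    by simp
  then have "t = 0 \<or> A = 0"
    by (auto simp: mat2_simps)
  \<comment> \<open>In the case \<open>A = 0\<close> the trace vanishes as well.\<close>
  then have "t = 0"
    by (auto simp: t_def)
  then have tr: "A$2$2 = - A$1$1"
    by (simp add: t_def add_eq_0_iff)
  then show "A$2$2 = - A$1$1 \<and> A$1$1 * A$1$1 + A$1$2 * A$2$1 = 0"
    by (simp flip: d)
next
  assume "A$2$2 = - A$1$1 \<and> A$1$1 * A$1$1 + A$1$2 * A$2$1 = 0"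
  then have "((**) A ^^ 2) (mat 1) = 0"
    by (simp add: numeral_2_eq_2 mat2_simps algebra_simps)
  then show "mat_nilpotent A"
    unfolding mat_nilpotent_def by blast
qed

lemma mat_nilpotent_0: "mat_nilpotent (0 :: 'a::field^2^2)"
  by (simp add: mat_nilpotent_iff)

text \<open>Trace zero leaves the equation bc = -a^2. If b is nonzero, a is free and c is determined
  (\<open>?f\<close>); if b = 0, then a = 0 and c is free (\<open>?g\<close>). The total is q(q - 1)
  + q.\<close>

lemma card_mat_nilpotent:
  "card {A :: 'a::{field,finite}^2^2. mat_nilpotent A} = CARD('a) ^ 2"
proof -
  let ?f = "\<lambda>(a, b). (a, b, - (a * a) / b, - a) :: 'a \<times> 'a \<times> 'a \<times> 'a"
  let ?g = "\<lambda>c. (0, 0, c, 0) :: 'a \<times> 'a \<times> 'a \<times> 'a"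
  have nil: "mat_nilpotent (mat2 (a, b, c, d)) \<longleftrightarrow>
      (b \<noteq> 0 \<and> c = - (a * a) / b \<and> d = - a) \<or> (b = 0 \<and> a = 0 \<and> d = 0)" for a b c d :: 'a
  proof (cases "b = 0")
    case False
    then have "b * c = - (a * a) \<longleftrightarrow> c = - (a * a) / b"
      by (simp only: eq_divide_eq mult.commute) simp
    then show ?thesis
      using False by (auto simp: mat_nilpotent_iff add_eq_0_iff)
  qed (auto simp: mat_nilpotent_iff)
  have "{x :: 'a \<times> 'a \<times> 'a \<times> 'a. mat_nilpotent (mat2 x)} = ?f ` (UNIV \<times> (UNIV - {0})) \<union> range ?g"
    by (auto simp: nil image_iff)
  moreover have "card (?f ` (UNIV \<times> (UNIV - {0}))) = CARD('a) * (CARD('a) - 1)"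
    by (subst card_image) (auto simp: inj_on_def card_cartesian_product card_Diff_singleton)
  moreover have "card (range ?g) = CARD('a)"
    by (subst card_image) (auto simp: inj_on_def)
  moreover have "?f ` (UNIV \<times> (UNIV - {0})) \<inter> range ?g = {}"
    by auto
  ultimately have "card {A :: 'a^2^2. mat_nilpotent A} = CARD('a) * (CARD('a) - 1) + CARD('a)"
    by (subst card_mat2_Collect) (simp add: card_Un_disjoint)
  also have "\<dots> = CARD('a) ^ 2"
    by (cases "CARD('a)") (auto simp: power2_eq_square)
  finally show ?thesis .
qed

text \<open>The singular matrices ad = bc are counted and subtracted from q^4: a nonzero determines
  d (\<open>?f\<close>); a zero first row leaves the second row free (\<open>?g\<close>); a = 0 with
  b nonzero forces c = 0 (\<open>?h\<close>). The result is an integer identity to avoid truncated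
  subtraction.\<close>

lemma card_invertible_mat2:
  "int (card {A :: 'a::{field,finite}^2^2. invertible A}) =
     (int CARD('a) ^ 2 - 1) * (int CARD('a) ^ 2 - int CARD('a))"
proof -
  let ?q = "CARD('a)"
  let ?X = "UNIV - {0} :: 'a set"
  let ?f = "\<lambda>(a, b, c). (a, b, c, b * c / a) :: 'a \<times> 'a \<times> 'a \<times> 'a"
  let ?g = "\<lambda>(c, d). (0, 0, c, d) :: 'a \<times> 'a \<times> 'a \<times> 'a"
  let ?h = "\<lambda>(b, d). (0, b, 0, d) :: 'a \<times> 'a \<times> 'a \<times> 'a"
  have "{x :: 'a \<times> 'a \<times> 'a \<times> 'a. \<not> invertible (mat2 x)}
      = ?f ` (?X \<times> UNIV \<times> UNIV) \<union> (range ?g \<union> ?h ` (?X \<times> UNIV))"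
    by (auto simp: invertible_det_nz det_2 image_iff field_simps split: if_splits)
  moreover have "card (?f ` (?X \<times> UNIV \<times> UNIV)) = (?q - 1) * (?q * ?q)"
    by (subst card_image) (auto simp: inj_on_def card_cartesian_product card_Diff_singleton)
  moreover have "card (range ?g) = ?q * ?q"
    by (subst card_image) (auto simp: inj_on_def card_cartesian_product simp flip: UNIV_Times_UNIV)
  moreover have "card (?h ` (?X \<times> UNIV)) = (?q - 1) * ?q"
    by (subst card_image) (auto simp: inj_on_def card_cartesian_product card_Diff_singleton)
  moreover have "?f ` (?X \<times> UNIV \<times> UNIV) \<inter> (range ?g \<union> ?h ` (?X \<times> UNIV)) = {}"
    "range ?g \<inter> ?h ` (?X \<times> UNIV) = {}"
    by auto
  ultimately have sing: "card {A :: 'a^2^2. \<not> invertible A}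
      = (?q - 1) * (?q * ?q) + (?q * ?q + (?q - 1) * ?q)"
    by (subst card_mat2_Collect) (simp add: card_Un_disjoint)
  have "card {A :: 'a^2^2. invertible A} + card {A :: 'a^2^2. \<not> invertible A}
      = card ({A :: 'a^2^2. invertible A} \<union> {A. \<not> invertible A})"
    by (rule card_Un_disjoint [symmetric]) auto
  also have "{A :: 'a^2^2. invertible A} \<union> {A. \<not> invertible A} = UNIV"
    by auto
  also have "CARD('a^2^2) = ?q ^ 4"
    by (simp add: CARD_vec flip: power_mult)
  finally have *: "card {A :: 'a^2^2. invertible A} + card {A :: 'a^2^2. \<not> invertible A} = ?q ^ 4" .
  have "?q \<ge> 1"
    by (simp add: Suc_leI)
  then have "int (?q - 1) = int ?q - 1"
    by simp
  then have "int (card {A :: 'a^2^2. invertible A})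
      + ((int ?q - 1) * (int ?q * int ?q) + (int ?q * int ?q + (int ?q - 1) * int ?q)) = int ?q ^ 4"
    using * sing by (metis (no_types, lifting) of_nat_add of_nat_mult of_nat_power)
  then show ?thesis
    by (simp add: algebra_simps power2_eq_square power4_eq_xxxx)
qed

section \<open>Centralizers of nilpotent matrices\<close>

lemma nilpotent_centralizer:
  fixes g N :: "'a::field^2^2"
  assumes N: "mat_nilpotent N" "N \<noteq> 0" and comm: "g ** N = N ** g"
  obtains s t where "g = mat s + mat t ** N"
proof -
  have n: "N$2$2 = - N$1$1" "N$1$1 * N$1$1 + N$1$2 * N$2$1 = 0"
    using N by (auto simp: mat_nilpotent_iff)
  have e: "g$1$2 * N$2$1 = N$1$2 * g$2$1"
      "g$1$1 * N$1$2 - g$1$2 * N$1$1 = N$1$1 * g$1$2 + N$1$2 * g$2$2"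
      "g$2$1 * N$1$1 + g$2$2 * N$2$1 = N$2$1 * g$1$1 - N$1$1 * g$2$1"
    using comm n(1) by (simp_all add: mat2_simps)
  show thesis
  proof (cases "N$1$2 = 0")
    case False
    \<comment> \<open>The off-diagonal entry of s + tN is t times that of N, so a nonzero
      off-diagonal entry of N fixes t; s is then read off the entry (1,1). The commutation equations
      confirm the other two entries.\<close>
    define t where "t = g$1$2 / N$1$2"
    have t: "g$1$2 = t * N$1$2"
      using False by (simp add: t_def)
    have "N$1$2 * (t * N$2$1) = N$1$2 * g$2$1"
      using e(1) unfolding t by (simp only: ac_simps)
    then have 1: "g$2$1 = t * N$2$1"
      using False by (metis mult_left_cancel)
    have "N$1$2 * (g$1$1 - t * N$1$1 - t * N$1$1) = N$1$2 * g$2$2"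
      using e(2) unfolding t by (simp add: algebra_simps)
    then have 2: "g$2$2 = g$1$1 - t * N$1$1 - t * N$1$1"
      using False by (metis mult_left_cancel)
    have "g = mat (g$1$1 - t * N$1$1) + mat t ** N"
      by (simp add: mat2_simps t 1 2 n(1))
    then show ?thesis
      by (rule that)
  next
    case True
    \<comment> \<open>With b = 0, determinant zero forces a = 0, so only the entry (2,1) of N can be
      nonzero.\<close>
    then have c: "N$2$1 \<noteq> 0"
      using N n by (auto simp: mat2_eq_iff)
    define t where "t = g$2$1 / N$2$1"
    have t: "g$2$1 = t * N$2$1"
      using c by (simp add: t_def)
    have 1: "g$1$2 = 0"
      using e(1) True c by simp
    have "N$2$1 * (g$1$1 - t * N$1$1 - t * N$1$1) = N$2$1 * g$2$2"
      using e(3) unfolding t by (simp add: algebra_simps)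
    then have 2: "g$2$2 = g$1$1 - t * N$1$1 - t * N$1$1"
      using c by (metis mult_left_cancel)
    have "g = mat (g$1$1 - t * N$1$1) + mat t ** N"
      by (simp add: mat2_simps t 1 2 n(1) True)
    then show ?thesis
      by (rule that)
  qed
qed

lemma mat_nilpotent_scale:
  assumes "mat_nilpotent (N :: 'a::field^2^2)"
  shows "mat_nilpotent (mat t ** N)"
proof -
  have "t * N$1$1 * (t * N$1$1) + t * N$1$2 * (t * N$2$1)
      = t * t * (N$1$1 * N$1$1 + N$1$2 * N$2$1)"
    by (simp add: algebra_simps)
  then show ?thesis
    using assms by (simp add: mat_nilpotent_iff mat2_simps)
qed

lemma det_scalar_plus_nilpotent:
  assumes "mat_nilpotent (N :: 'a::field^2^2)"
  shows "det (mat s + N) = s * s"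
  using assms by (auto simp: mat_nilpotent_iff det_2 mat2_simps algebra_simps)

text \<open>The determinant of M is s^2 by its decomposition and 0 by nilpotency. This makes the
  decomposition into a scalar and a nilpotent part unique in every characteristic.\<close>

lemma nilpotent_scalar_plus:
  fixes M N :: "'a::field^2^2"
  assumes "mat_nilpotent M" "mat_nilpotent N" "M = mat s + N"
  shows "s = 0"
  using det_scalar_plus_nilpotent[OF assms(2), of s] det_scalar_plus_nilpotent[OF assms(1), of 0] assms(3)
  by simp

text \<open>For invertible \<open>g\<close> these are the nilpotent matrices fixed under conjugation
  by \<open>g\<close>. Stated by commutation, it also applies to singular matrices, hence to the
  nilpotent part of \<open>g\<close>.\<close>

definition nil_centralizer :: "'a::field^2^2 \<Rightarrow> ('a^2^2) set" where
  "nil_centralizer g = {N. mat_nilpotent N \<and> g ** N = N ** g}"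

lemma nil_centralizer_scalar_plus:
  "nil_centralizer (mat s + N) = nil_centralizer N"
  by (auto simp: nil_centralizer_def mat2_simps algebra_simps)

lemma card_nil_centralizer_0:
  "card (nil_centralizer (0 :: 'a::{field,finite}^2^2)) = CARD('a) ^ 2"
  by (simp add: nil_centralizer_def card_mat_nilpotent)

text \<open>A nilpotent matrix s + tN has s = 0, so exactly the q distinct multiples of N
  remain.\<close>

lemma card_nil_centralizer_nilpotent:
  fixes N :: "'a::{field,finite}^2^2"
  assumes N: "mat_nilpotent N" "N \<noteq> 0"
  shows "card (nil_centralizer N) = CARD('a)"
proof -
  have "nil_centralizer N = range (\<lambda>t. mat t ** N)"
  proof (intro equalityI subsetI)
    fix M assume M: "M \<in> nil_centralizer N"
    then obtain s t where st: "M = mat s + mat t ** N"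
      using nilpotent_centralizer[OF N, of M] by (auto simp: nil_centralizer_def)
    then have "s = 0"
      using nilpotent_scalar_plus[OF _ mat_nilpotent_scale[OF N(1)] st] M
      by (simp add: nil_centralizer_def)
    then show "M \<in> range (\<lambda>t. mat t ** N)"
      using st by simp
  next
    fix M assume "M \<in> range (\<lambda>t. mat t ** N)"
    then show "M \<in> nil_centralizer N"
      using N mat_nilpotent_scale[OF N(1)]
      by (auto simp: nil_centralizer_def mat2_simps algebra_simps)
  qed
  moreover have "inj (\<lambda>t. mat t ** N)"
    using N(2) by (auto simp: inj_on_def mat2_simps)
  ultimately show ?thesis
    by (simp add: card_image)
qed

lemma inj_on_scalar_plus_nilpotent:
  "inj_on (\<lambda>(s, N). mat s + N) (UNIV \<times> {N :: 'a::field^2^2. mat_nilpotent N})"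
proof (rule inj_onI, clarsimp)
  fix s s' and N N' :: "'a^2^2"
  assume N: "mat_nilpotent N" "mat_nilpotent N'" and eq: "mat s + N = mat s' + N'"
  then have "N = mat (s' - s) + N'"
    by (auto simp: mat2_simps algebra_simps)
  with N have "s' - s = 0"
    by (rule nilpotent_scalar_plus)
  with eq show "s = s' \<and> N = N'"
    by simp
qed

lemma sum_card_nil_centralizer_power:
  fixes m :: nat
  defines "q \<equiv> int CARD('a::{field,finite})"
  shows "(\<Sum>g\<in>{g :: 'a^2^2. invertible g}. int (card (nil_centralizer g) ^ m))
     = (q - 1) * (q ^ (2 * m) + (q\<^sup>2 - 1) * q ^ m + q ^ 3 - q - q\<^sup>2)"
proof -
  let ?G = "{g :: 'a^2^2. invertible g}"
  let ?N = "{N :: 'a^2^2. mat_nilpotent N}"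
  let ?f = "\<lambda>g :: 'a^2^2. int (card (nil_centralizer g) ^ m)"
  let ?p = "\<lambda>(s :: 'a, N :: 'a^2^2). mat s + N"
  define D where "D = (UNIV - {0 :: 'a}) \<times> ?N"
  have inj: "inj_on ?p D"
    by (rule inj_on_subset[OF inj_on_scalar_plus_nilpotent]) (auto simp: D_def)
  have card_X: "int (card (UNIV - {0 :: 'a})) = q - 1"
    by (simp add: q_def card_Diff_singleton Suc_leI)
  have card_N: "int (card ?N) = q\<^sup>2"
    by (simp add: card_mat_nilpotent q_def)
  have card_N': "int (card (?N - {0})) = q\<^sup>2 - 1"
    using card_N by (simp add: card_Diff_singleton mat_nilpotent_0 card_mat_nilpotent q_def Suc_leI)
  have sub: "?p ` D \<subseteq> ?G"
    by (auto simp: D_def invertible_det_nz det_scalar_plus_nilpotent)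
  have "sum ?f ?G = sum ?f (?G - ?p ` D) + sum ?f (?p ` D)"
    by (rule sum.subset_diff[OF sub]) simp
  also have "sum ?f (?G - ?p ` D) = (\<Sum>g\<in>?G - ?p ` D. 1)"
  proof (rule sum.cong[OF refl])
    fix g assume g: "g \<in> ?G - ?p ` D"
    have "N = 0" if N: "N \<in> nil_centralizer g" for N
    proof (rule ccontr)
      assume "N \<noteq> 0"
      with N obtain s t where st: "g = mat s + mat t ** N"
        using nilpotent_centralizer[of N g] by (auto simp: nil_centralizer_def)
      have nil: "mat_nilpotent (mat t ** N)"
        using N mat_nilpotent_scale by (auto simp: nil_centralizer_def)
      with g st have "s \<noteq> 0"
        by (auto simp: invertible_det_nz det_scalar_plus_nilpotent)
      with st nil have "g \<in> ?p ` D"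
        by (auto simp: D_def image_iff)
      with g show False
        by simp
    qed
    moreover have "0 \<in> nil_centralizer g"
      by (simp add: nil_centralizer_def mat_nilpotent_0)
    ultimately have "nil_centralizer g = {0}"
      by blast
    then show "?f g = 1"
      by simp
  qed
  also have "\<dots> = int (card ?G) - int (card (?p ` D))"
    using sub by (simp add: card_Diff_subset card_mono of_nat_diff)
  also have "int (card (?p ` D)) = (q - 1) * q\<^sup>2"
    by (simp only: card_image[OF inj]) (simp only: D_def card_cartesian_product of_nat_mult card_X card_N)
  also have "sum ?f (?p ` D) = (\<Sum>x\<in>D. ?f (?p x))"
    by (simp only: sum.reindex[OF inj] o_def)
  also have "\<dots> = (\<Sum>s\<in>UNIV - {0 :: 'a}. \<Sum>N\<in>?N. ?f (mat s + N))"
    by (simp add: D_def sum.cartesian_product case_prod_unfold)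
  also have "\<dots> = (q - 1) * (\<Sum>N\<in>?N. ?f N)"
    by (simp add: nil_centralizer_scalar_plus flip: card_X)
  also have "(\<Sum>N\<in>?N. ?f N) = ?f 0 + (\<Sum>N\<in>?N - {0}. ?f N)"
    by (rule sum.remove) (auto simp: mat_nilpotent_0)
  also have "(\<Sum>N\<in>?N - {0}. ?f N) = (q\<^sup>2 - 1) * q ^ m"
    by (simp add: card_nil_centralizer_nilpotent q_def flip: card_N'[unfolded q_def])
  also have "?f 0 = q ^ (2 * m)"
    by (simp add: card_nil_centralizer_0 q_def power_mult)
  also have "int (card ?G) = (q\<^sup>2 - 1) * (q\<^sup>2 - q)"
    by (simp add: card_invertible_mat2 q_def)
  finally show ?thesis
    by (simp add: algebra_simps power2_eq_square power3_eq_cube)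
qed

section \<open>Counting orbits\<close>

definition GL2 :: "('a::field^2^2) monoid" where
  "GL2 = \<lparr>carrier = {g. invertible g}, mult = (**), one = mat 1\<rparr>"

lemma GL2_simps [simp]:
  "carrier GL2 = {g. invertible g}" "mult GL2 = (**)" "one GL2 = mat 1"
  by (simp_all add: GL2_def)

lemma matrix_inv_mult:
  assumes "invertible (g :: 'a::field^'n^'n)"
  shows "g ** matrix_inv g = mat 1" "matrix_inv g ** g = mat 1"
  using assms unfolding invertible_def matrix_inv_def by (metis (mono_tags, lifting) someI_ex)+

lemma invertible_matrix_inv:
  "invertible (g :: 'a::field^'n^'n) \<Longrightarrow> invertible (matrix_inv g)"
  using matrix_inv_mult[of g] by (auto simp: invertible_def[of "matrix_inv g"])

lemma group_GL2: "group (GL2 :: ('a::field^2^2) monoid)"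
proof (rule groupI)
  fix g :: "'a^2^2" assume g: "g \<in> carrier GL2"
  then have "invertible (matrix_inv g)"
    by (simp add: invertible_matrix_inv)
  with g show "\<exists>h\<in>carrier GL2. h \<otimes>\<^bsub>GL2\<^esub> g = \<one>\<^bsub>GL2\<^esub>"
    using matrix_inv_mult[of g] by auto
qed (auto simp: invertible_det_nz det_mul matrix_mul_assoc)

lemma matrix_inv_matrix_mult:
  assumes "invertible (g :: 'a::field^'n^'n)" "invertible (h :: 'a^'n^'n)"
  shows "matrix_inv (g ** h) = matrix_inv h ** matrix_inv g"
proof -
  have gh: "invertible (g ** h)"
    using assms by (rule invertible_mult)
  have "(matrix_inv h ** matrix_inv g) ** (g ** h) = matrix_inv h ** (matrix_inv g ** g) ** h"
    by (simp only: matrix_mul_assoc)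
  also have "\<dots> = mat 1"
    using assms by (simp add: matrix_inv_mult)
  finally have "matrix_inv (g ** h) = ((matrix_inv h ** matrix_inv g) ** (g ** h)) ** matrix_inv (g ** h)"
    by simp
  also have "\<dots> = (matrix_inv h ** matrix_inv g) ** ((g ** h) ** matrix_inv (g ** h))"
    by (simp only: matrix_mul_assoc)
  finally show ?thesis
    using gh by (simp add: matrix_inv_mult)
qed

lemma mat_nilpotent_conj:
  assumes "mat_nilpotent (A :: 'a::field^'n^'n)" "invertible (g :: 'a^'n^'n)"
  shows "mat_nilpotent (g ** A ** matrix_inv g)"
proof -
  have zero: "g ** (0 :: 'a^'n^'n) ** matrix_inv g = 0"
    by (simp add: matrix_matrix_mult_def vec_eq_iff)
  have "((**) (g ** A ** matrix_inv g) ^^ n) (mat 1) = g ** ((**) A ^^ n) (mat 1) ** matrix_inv g" for n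
  proof (induction n)
    case 0
    then show ?case
      using assms by (simp add: matrix_inv_mult)
  next
    case (Suc n)
    let ?X = "((**) A ^^ n) (mat 1)"
    have "(g ** A ** matrix_inv g) ** (g ** ?X ** matrix_inv g)
        = g ** A ** (matrix_inv g ** g) ** ?X ** matrix_inv g"
      by (simp only: matrix_mul_assoc)
    also have "\<dots> = g ** (A ** ?X) ** matrix_inv g"
      using assms by (simp add: matrix_inv_mult matrix_mul_assoc)
    finally show ?case
      using Suc by simp
  qed
  then show ?thesis
    using assms(1) unfolding mat_nilpotent_def by (metis zero)
qed

lemma conj_act_nil_tuples:
  "invertible g \<Longrightarrow> A \<in> nil_tuples m \<Longrightarrow> conj_act m g A \<in> nil_tuples m"
  by (auto simp: nil_tuples_def conj_act_def PiE_iff intro!: mat_nilpotent_conj)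

lemma conj_act_mult:
  assumes "invertible g" "invertible h"
  shows "conj_act m g (conj_act m h A) = conj_act m (g ** h) A"
  using assms by (auto simp: conj_act_def fun_eq_iff matrix_inv_matrix_mult matrix_mul_assoc)

text \<open>Membership supplies extensionality: \<open>conj_act\<close> returns
  \<open>undefined\<close> outside \<open>{1..m}\<close>, and so does a tuple in
  \<open>nil_tuples m\<close>.\<close>

lemma conj_act_one: "A \<in> nil_tuples m \<Longrightarrow> conj_act m (mat 1) A = A"
proof -
  have "matrix_inv (mat 1 :: 'a^2^2) = mat 1"
    using matrix_inv_mult(1)[of "mat 1 :: 'a^2^2"] by (simp add: invertible_det_nz)
  then show "A \<in> nil_tuples m \<Longrightarrow> conj_act m (mat 1) A = A"
    by (auto simp: conj_act_def nil_tuples_def fun_eq_iff PiE_def extensional_def)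
qed

text \<open>An action is a homomorphism into \<open>BijGroup\<close>, whose elements are extensional
  bijections; hence the restriction of \<open>conj_act\<close> to the tuples. Conjugation by the
  inverse matrix witnesses bijectivity.\<close>

lemma group_action_conj_act:
  "group_action (GL2 :: ('a::field^2^2) monoid) (nil_tuples m) (\<lambda>g. \<lambda>A\<in>nil_tuples m. conj_act m g A)"
proof -
  let ?E = "nil_tuples m :: (nat \<Rightarrow> 'a^2^2) set"
  let ?\<phi> = "\<lambda>g. \<lambda>A\<in>?E. conj_act m g A"
  have Bij: "?\<phi> g \<in> Bij ?E" if g: "invertible g" for g
  proof -
    have inv: "invertible (matrix_inv g)"
      using g by (rule invertible_matrix_inv)
    have "bij_betw (conj_act m g) ?E ?E"
      by (rule bij_betw_byWitness[where f' = "conj_act m (matrix_inv g)"])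
        (auto simp: conj_act_mult conj_act_one conj_act_nil_tuples g inv matrix_inv_mult)
    then have "bij_betw (?\<phi> g) ?E ?E"
      by (simp cong: bij_betw_cong)
    then show ?thesis
      by (simp add: Bij_def)
  qed
  have "?\<phi> \<in> hom GL2 (BijGroup ?E)"
  proof (rule homI)
    fix g :: "'a^2^2" assume "g \<in> carrier GL2"
    then show "?\<phi> g \<in> carrier (BijGroup ?E)"
      using Bij by (simp add: BijGroup_def)
  next
    fix g h :: "'a^2^2" assume "g \<in> carrier GL2" "h \<in> carrier GL2"
    then show "?\<phi> (g \<otimes>\<^bsub>GL2\<^esub> h) = ?\<phi> g \<otimes>\<^bsub>BijGroup ?E\<^esub> ?\<phi> h"
      using Bij by (auto simp: BijGroup_def compose_def fun_eq_iff conj_act_mult conj_act_nil_tuples)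
  qed
  then show ?thesis
    by (simp add: group_action_def group_hom_def group_hom_axioms_def group_GL2 group_BijGroup)
qed

lemma orbits_conj_act:
  "orbits GL2 (nil_tuples m) (\<lambda>g. \<lambda>A\<in>nil_tuples m. conj_act m g A) = GL2_orbits m"
  by (auto simp: orbits_def orbit_def GL2_orbits_def GL2_orbit_def)

section \<open>Fixed points and Burnside's lemma\<close>

lemma conj_fixed_iff:
  assumes "invertible (g :: 'a::field^'n^'n)"
  shows "g ** A ** matrix_inv g = A \<longleftrightarrow> g ** A = A ** g"
proof
  assume "g ** A ** matrix_inv g = A"
  then have "A ** g = g ** A ** matrix_inv g ** g"
    by simp
  also have "\<dots> = g ** A ** (matrix_inv g ** g)"
    by (simp only: matrix_mul_assoc)
  finally show "g ** A = A ** g"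
    using assms by (simp add: matrix_inv_mult)
next
  assume "g ** A = A ** g"
  then have "g ** A ** matrix_inv g = A ** (g ** matrix_inv g)"
    by (simp only: matrix_mul_assoc)
  then show "g ** A ** matrix_inv g = A"
    using assms by (simp add: matrix_inv_mult)
qed

text \<open>Simultaneous conjugation fixes a tuple exactly if it fixes each component. The fixed set
  is thus a product of m equal factors, which gives the m-th powers in Burnside's sum.\<close>

lemma invariants_conj_act:
  assumes "invertible (g :: 'a::field^2^2)"
  shows "invariants (nil_tuples m) (\<lambda>g. \<lambda>A\<in>nil_tuples m. conj_act m g A) g
     = (\<Pi>\<^sub>E k\<in>{1..m}. nil_centralizer g)"
proof -
  have fixed: "conj_act m g A = A \<longleftrightarrow> (\<forall>k\<in>{1..m}. g ** A k = A k ** g)"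
    if "A \<in> nil_tuples m" for A
  proof -
    have "A \<in> extensional {1..m}"
      using that by (simp add: nil_tuples_def PiE_iff)
    then have "conj_act m g A = A \<longleftrightarrow> (\<forall>k\<in>{1..m}. conj_act m g A k = A k)"
      by (metis conj_act_def extensionalityI restrict_extensional)
    then show ?thesis
      by (simp add: conj_act_def conj_fixed_iff[OF assms])
  qed
  have "invariants (nil_tuples m) (\<lambda>g. \<lambda>A\<in>nil_tuples m. conj_act m g A) g
      = {A \<in> nil_tuples m. \<forall>k\<in>{1..m}. g ** A k = A k ** g}"
    using fixed by (auto simp: invariants_def)
  also have "\<dots> = (\<Pi>\<^sub>E k\<in>{1..m}. nil_centralizer g)"
    by (auto simp: nil_tuples_def nil_centralizer_def PiE_iff extensional_def)
  finally show ?thesis .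
qed

lemma finite_nil_tuples: "finite (nil_tuples m :: (nat \<Rightarrow> 'a::{field,finite}^2^2) set)"
  unfolding nil_tuples_def by (intro finite_PiE) auto

lemma card_GL2_orbits:
  fixes m :: nat
  defines "q \<equiv> int CARD('a::{field,finite})"
  assumes m: "m \<ge> 1"
  shows "int (card (GL2_orbits m :: (nat \<Rightarrow> 'a^2^2) set set)) * (q\<^sup>2 - 1)
     = (q\<^sup>2 - 1) + (q ^ m - 1) * (q ^ (m - 1) + q)"
proof -
  let ?K = "int (card (GL2_orbits m :: (nat \<Rightarrow> 'a^2^2) set set))"
  let ?\<phi> = "\<lambda>g. \<lambda>A\<in>nil_tuples m :: (nat \<Rightarrow> 'a^2^2) set. conj_act m g A"
  have "card (orbits GL2 (nil_tuples m) ?\<phi>) * order (GL2 :: ('a^2^2) monoid)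
      = (\<Sum>g\<in>carrier GL2. card (invariants (nil_tuples m) ?\<phi> g))"
    by (rule group_action.burnside[OF group_action_conj_act]) (auto simp: finite_nil_tuples)
  also have "\<dots> = (\<Sum>g\<in>{g :: 'a^2^2. invertible g}. card (nil_centralizer g) ^ m)"
    by (rule sum.cong) (auto simp: invariants_conj_act card_PiE)
  finally have "?K * int (card {g :: 'a^2^2. invertible g})
      = (\<Sum>g\<in>{g :: 'a^2^2. invertible g}. int (card (nil_centralizer g) ^ m))"
    unfolding orbits_conj_act order_def
    by (metis (no_types, lifting) GL2_simps(1) of_nat_mult of_nat_sum sum.cong)
  then have *: "?K * ((q\<^sup>2 - 1) * (q\<^sup>2 - q))
      = (q - 1) * (q ^ (2 * m) + (q\<^sup>2 - 1) * q ^ m + q ^ 3 - q - q\<^sup>2)"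
    unfolding sum_card_nil_centralizer_power card_invertible_mat2 q_def .
  have "CARD('a) \<ge> card {0, 1 :: 'a}"
    by (rule card_mono) auto
  then have q2: "q \<ge> 2"
    by (simp add: q_def)
  obtain n where n: "m = Suc n"
    using m by (cases m) auto
  \<comment> \<open>With x = q^(m - 1), all powers become monomials in q and x, and the claim is a
    polynomial identity. The factor q(q - 1) is what the group order has beyond q^2 - 1.\<close>
  define x where "x = q ^ n"
  have pow: "q ^ m = q * x" "q ^ (m - 1) = x" "q ^ (2 * m) = q * q * x * x"
    by (simp_all add: n x_def mult_2 power_add)
  have "(q * (q - 1)) * (?K * (q\<^sup>2 - 1))
      = (q * (q - 1)) * ((q\<^sup>2 - 1) + (q ^ m - 1) * (q ^ (m - 1) + q))"
    using * unfolding pow by (simp add: algebra_simps power2_eq_square power3_eq_cube)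
  then show ?thesis
    using q2 by simp
qed

section \<open>The orbit count as a polynomial in the field size\<close>

text \<open>The bound admits k = -1, where both sides vanish; this covers the last index of the odd
  branch at m = 1.\<close>

lemma geom_S_mult:
  fixes x :: "'r::comm_ring_1"
  assumes "k \<ge> -1"
  shows "(x - 1) * geom_S k x = x ^ nat (k + 1) - 1"
proof (cases "k = -1")
  case True
  then show ?thesis
    by (simp add: geom_S_def)
next
  case False
  then have "k \<ge> 0"
    using assms by simp
  then show ?thesis
    using power_diff_1_eq[of x "Suc (nat k)"] by (simp add: geom_S_def lessThan_Suc_atMost nat_add_distrib)
qed

text \<open>Multiplication by x^2 - 1 = (x + 1)(x - 1) telescopes both geometric sums. In either
  parity the last term becomes (x^m - 1)(x^(m-1) - 1), the branches merely exchanging which factor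
  comes from the sum in x^2. Adding (x + 1)(x^m - 1) gives the claim.\<close>

lemma kappa_expr_mult:
  fixes x :: "'r::comm_ring_1"
  assumes "m \<ge> 1"
  shows "(x\<^sup>2 - 1) * kappa_expr m x = (x\<^sup>2 - 1) + (x ^ m - 1) * (x ^ (m - 1) + x)"
proof -
  have S: "(x - 1) * geom_S (int m - 1) x = x ^ m - 1"
    using geom_S_mult[of "int m - 1" x] assms by simp
  have fac: "x\<^sup>2 - 1 = (x + 1) * (x - 1)"
    by (simp add: algebra_simps power2_eq_square)
  show ?thesis
  proof (cases "even m")
    case True
    then obtain n where n: "m = 2 * n"
      by auto
    have T: "(x\<^sup>2 - 1) * geom_S ((int m - 2) div 2) (x\<^sup>2) = x ^ m - 1"
    proof -
      have "(int m - 2) div 2 = int n - 1"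
        by (simp add: n)
      then show ?thesis
        using geom_S_mult[of "int n - 1" "x\<^sup>2"] assms by (simp add: n power_mult)
    qed
    have "(x\<^sup>2 - 1) * kappa_expr m x = (x\<^sup>2 - 1) + (x + 1) * ((x - 1) * geom_S (int m - 1) x)
        + (x ^ (m - 1) - 1) * ((x\<^sup>2 - 1) * geom_S ((int m - 2) div 2) (x\<^sup>2))"
      using True by (simp add: kappa_expr_def fac algebra_simps)
    then show ?thesis
      unfolding S T by (simp add: algebra_simps)
  next
    case False
    then obtain n where n: "m = 2 * n + 1"
      by (auto elim: oddE)
    have T: "(x\<^sup>2 - 1) * geom_S ((int m - 3) div 2) (x\<^sup>2) = x ^ (m - 1) - 1"
    proof -
      have "(int m - 3) div 2 = int n - 1"
        by (simp add: n)
      then show ?thesis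
        using geom_S_mult[of "int n - 1" "x\<^sup>2"] assms by (simp add: n power_mult)
    qed
    have "(x\<^sup>2 - 1) * kappa_expr m x = (x\<^sup>2 - 1) + (x + 1) * ((x - 1) * geom_S (int m - 1) x)
        + (x ^ m - 1) * ((x\<^sup>2 - 1) * geom_S ((int m - 3) div 2) (x\<^sup>2))"
      using False by (simp add: kappa_expr_def fac algebra_simps)
    then show ?thesis
      unfolding S T by (simp add: algebra_simps)
  qed
qed

section \<open>Evaluation and coefficients of the orbit polynomial\<close>

lemma poly_geom_S: "poly (geom_S k p) x = geom_S k (poly p x)"
  by (simp add: geom_S_def poly_sum)

lemma poly_kappa_expr: "poly (kappa_expr m p) x = kappa_expr m (poly p x)"
  by (simp add: kappa_expr_def poly_geom_S)

lemma of_int_geom_S: "of_int (geom_S k x) = geom_S k (of_int x)"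
  by (simp add: geom_S_def)

lemma of_int_kappa_expr: "of_int (kappa_expr m x) = kappa_expr m (of_int x)"
  by (simp add: kappa_expr_def of_int_geom_S)

lemma coeff_X_power: "coeff ([:0, 1:] ^ n) i = (if i = n then 1 else 0 :: 'r::comm_semiring_1)"
  by (simp flip: monom_altdef[of 1, simplified])

lemma coeff_geom_S:
  "coeff (geom_S (int m - 1) [:0, 1 :: int:]) i = (if i < m then 1 else 0)"
  by (auto simp: geom_S_def coeff_sum coeff_X_power sum.delta' nat_diff_distrib)

lemma coeff_geom_S_square:
  "coeff (geom_S k ([:0, 1 :: int:]\<^sup>2)) i = (if even i \<and> int i \<le> 2 * k then 1 else 0)"
proof (cases "k < 0")
  case True
  then show ?thesis
    by (simp add: geom_S_def)
next
  case False
  have "coeff (geom_S k ([:0, 1 :: int:]\<^sup>2)) i = (\<Sum>j\<le>nat k. if i = 2 * j then 1 else 0)"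
    using False by (simp add: geom_S_def coeff_sum coeff_X_power flip: power_mult)
  also have "\<dots> = (if even i \<and> int i \<le> 2 * k then 1 else 0)"
  proof (cases "even i")
    case True
    then obtain l where "i = 2 * l"
      by auto
    then show ?thesis
      using False by (auto simp: sum.delta')
  qed (auto intro!: sum.neutral)
  finally show ?thesis .
qed

text \<open>The only negative contribution is minus the sum of even powers up to 2k. As 2k < m in
  both branches, each of these monomials occurs in the full sum up to degree m - 1, so the
  difference has coefficients 0 and 1.\<close>

lemma coeff_kappa_expr_nonneg: "coeff (kappa_expr m [:0, 1 :: int:]) i \<ge> 0"
proof -
  have shift: "coeff (([:0, 1 :: int:] ^ n) * p) i \<ge> 0" if "\<And>j. coeff p j \<ge> 0" for n p
    using that by (simp add: coeff_monom_mult flip: monom_altdef[of 1, simplified])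
  have main: "coeff (1 + geom_S (int m - 1) [:0, 1:] + ([:0, 1:] ^ n - 1) * geom_S k ([:0, 1 :: int:]\<^sup>2)) i \<ge> 0"
    if "2 * k < int m" for n k
  proof -
    have eq: "1 + geom_S (int m - 1) [:0, 1:] + ([:0, 1:] ^ n - 1) * geom_S k ([:0, 1 :: int:]\<^sup>2)
      = 1 + (geom_S (int m - 1) [:0, 1:] - geom_S k ([:0, 1 :: int:]\<^sup>2))
        + [:0, 1:] ^ n * geom_S k ([:0, 1 :: int:]\<^sup>2)"
      by (simp add: algebra_simps)
    have 1: "coeff ([:0, 1:] ^ n * geom_S k ([:0, 1 :: int:]\<^sup>2)) i \<ge> 0"
      by (rule shift) (simp add: coeff_geom_S_square)
    have 2: "coeff (geom_S (int m - 1) [:0, 1:] - geom_S k ([:0, 1 :: int:]\<^sup>2)) i \<ge> 0"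
      using that by (simp add: coeff_geom_S coeff_geom_S_square)
    show ?thesis
      unfolding eq coeff_add[of _ _ i] by (intro add_nonneg_nonneg 1 2) (simp add: coeff_1)
  qed
  show ?thesis
  proof (cases "even m")
    case True
    show ?thesis
      unfolding kappa_expr_def if_P[OF True] by (rule main) presburger
  next
    case False
    show ?thesis
      unfolding kappa_expr_def if_not_P[OF False] by (rule main) presburger
  qed
qed

section \<open>Separating sets over a finite field\<close>

lemma coord_ring_extensional: "f \<in> coord_ring m \<Longrightarrow> f \<in> extensional (nil_tuples m)"
  by (induction rule: coord_ring.induct) (auto simp: extensional_def)

lemma coord_ring_sum:
  assumes "finite I" "\<And>i. i \<in> I \<Longrightarrow> restrict (f i) (nil_tuples m) \<in> coord_ring m"
  shows "(\<lambda>A\<in>nil_tuples m. \<Sum>i\<in>I. f i A) \<in> coord_ring m"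
  using assms
proof (induction I rule: finite_induct)
  case empty
  then show ?case
    by (simp only: sum.empty coord_ring.const)
next
  case (insert i I)
  \<comment> \<open>The inner restrictions give the expression the literal shape of
    \<open>coord_ring.add\<close>; they do not change values on \<open>nil_tuples m\<close>.\<close>
  have "(\<lambda>A\<in>nil_tuples m. \<Sum>i\<in>insert i I. f i A)
      = (\<lambda>A\<in>nil_tuples m. restrict (f i) (nil_tuples m) A + (\<lambda>A\<in>nil_tuples m. \<Sum>i\<in>I. f i A) A)"
    using insert.hyps by (intro restrict_ext) simp
  also have "\<dots> \<in> coord_ring m"
    using insert by (intro coord_ring.add) auto
  finally show ?case .
qed

lemma coord_ring_prod:
  assumes "finite I" "\<And>i. i \<in> I \<Longrightarrow> restrict (f i) (nil_tuples m) \<in> coord_ring m"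
  shows "(\<lambda>A\<in>nil_tuples m. \<Prod>i\<in>I. f i A) \<in> coord_ring m"
  using assms
proof (induction I rule: finite_induct)
  case empty
  then show ?case
    by (simp only: prod.empty coord_ring.const)
next
  case (insert i I)
  have "(\<lambda>A\<in>nil_tuples m. \<Prod>i\<in>insert i I. f i A)
      = (\<lambda>A\<in>nil_tuples m. restrict (f i) (nil_tuples m) A * (\<lambda>A\<in>nil_tuples m. \<Prod>i\<in>I. f i A) A)"
    using insert.hyps by (intro restrict_ext) simp
  also have "\<dots> \<in> coord_ring m"
    using insert by (intro coord_ring.mult) auto
  finally show ?case .
qed

lemma coord_ring_entry_affine:
  assumes "k \<in> {1..m}"
  shows "(\<lambda>A\<in>nil_tuples m. (A k $ i $ j - c) / d) \<in> coord_ring m"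
proof -
  let ?E = "nil_tuples m"
  have "(\<lambda>A\<in>?E. (\<lambda>A\<in>?E. A k $ i $ j) A + (\<lambda>A\<in>?E. - c) A) \<in> coord_ring m"
    by (intro coord_ring.intros assms)
  then have "(\<lambda>A\<in>?E. A k $ i $ j - c) \<in> coord_ring m"
    by (simp cong: restrict_cong)
  then have "(\<lambda>A\<in>?E. (\<lambda>A\<in>?E. A k $ i $ j - c) A * (\<lambda>A\<in>?E. inverse d) A) \<in> coord_ring m"
    by (intro coord_ring.intros)
  then show ?thesis
    by (simp add: divide_inverse cong: restrict_cong)
qed

text \<open>Lagrange interpolation in each matrix entry.\<close>

lemma coord_ring_indicator:
  fixes P :: "nat \<Rightarrow> 'a::{field,finite}^2^2"
  assumes P: "P \<in> nil_tuples m"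
  shows "(\<lambda>A\<in>nil_tuples m. if A = P then 1 else 0) \<in> coord_ring m"
proof -
  let ?E = "nil_tuples m :: (nat \<Rightarrow> 'a^2^2) set"
  let ?I = "{1..m} \<times> (UNIV :: 2 set) \<times> (UNIV :: 2 set)"
  \<comment> \<open>One Lagrange basis polynomial per entry: 1 where that entry agrees with
    \<open>P\<close>, and 0 at every other field element.\<close>
  define F :: "nat \<times> 2 \<times> 2 \<Rightarrow> (nat \<Rightarrow> 'a^2^2) \<Rightarrow> 'a" where
    "F = (\<lambda>(k, i, j) A. \<Prod>c\<in>UNIV - {P k $ i $ j}. (A k $ i $ j - c) / (P k $ i $ j - c))"
  have val: "F (k, i, j) A = (if A k $ i $ j = P k $ i $ j then 1 else 0)" for k i j A
    by (auto simp: F_def)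
  have "(\<Prod>x\<in>?I. F x A) = (if A = P then 1 else 0)" if A: "A \<in> ?E" for A
  proof (cases "A = P")
    case False
    \<comment> \<open>Both tuples are \<open>undefined\<close> outside \<open>{1..m}\<close>, so
      they must differ at an index inside.\<close>
    have "\<exists>k\<in>{1..m}. A k \<noteq> P k"
      using A P False unfolding nil_tuples_def by (meson PiE_ext)
    then obtain k i j where "k \<in> {1..m}" "A k $ i $ j \<noteq> P k $ i $ j"
      by (auto simp: vec_eq_iff)
    then have "\<exists>x\<in>?I. F x A = 0"
      by (intro bexI[of _ "(k, i, j)"]) (simp_all add: val)
    then show ?thesis
      using False by (simp add: prod_zero)
  qed (auto intro!: prod.neutral simp: val)
  then have "(\<lambda>A\<in>?E. if A = P then 1 else 0) = (\<lambda>A\<in>?E. \<Prod>x\<in>?I. F x A)"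
    by (intro restrict_ext) simp
  also have "\<dots> \<in> coord_ring m"
  proof (rule coord_ring_prod)
    fix x assume "x \<in> ?I"
    then show "restrict (F x) ?E \<in> coord_ring m"
      by (cases x) (auto simp: F_def intro!: coord_ring_prod coord_ring_entry_affine)
  qed simp
  finally show ?thesis .
qed

text \<open>The set of tuples is finite, so any function on it is a linear combination of indicators
  of points.\<close>

lemma coord_ring_eq_extensional:
  "(coord_ring m :: ((nat \<Rightarrow> 'a::{field,finite}^2^2) \<Rightarrow> 'a) set) = extensional (nil_tuples m)"
proof (intro equalityI subsetI)
  fix f :: "(nat \<Rightarrow> 'a^2^2) \<Rightarrow> 'a" assume f: "f \<in> extensional (nil_tuples m)"
  let ?E = "nil_tuples m :: (nat \<Rightarrow> 'a^2^2) set"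
  have "(\<lambda>A\<in>?E. (\<lambda>A\<in>?E. f P) A * (\<lambda>A\<in>?E. if A = P then 1 else 0) A) \<in> coord_ring m" if "P \<in> ?E" for P
    using that by (intro coord_ring.mult coord_ring.const coord_ring_indicator)
  then have "(\<lambda>A\<in>?E. f P * (if A = P then 1 else 0)) \<in> coord_ring m" if "P \<in> ?E" for P
    using that by (simp cong: restrict_cong)
  then have "(\<lambda>A\<in>?E. \<Sum>P\<in>?E. f P * (if A = P then 1 else 0)) \<in> coord_ring m"
    by (intro coord_ring_sum finite_nil_tuples) auto
  also have "(\<lambda>A\<in>?E. \<Sum>P\<in>?E. f P * (if A = P then 1 else 0)) = restrict f ?E"
    by (rule restrict_ext) (simp add: finite_nil_tuples if_distrib[of "(*) _"] cong: if_cong)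
  finally show "f \<in> coord_ring m"
    using f by (simp add: extensional_restrict)
qed (rule coord_ring_extensional)

section \<open>Orbits, invariants and separation\<close>

lemma GL2_orbit_eq:
  assumes "A \<in> nil_tuples m" "B \<in> GL2_orbit m A"
  shows "GL2_orbit m B = GL2_orbit m A"
proof -
  obtain g where g: "invertible g" "B = conj_act m g A"
    using assms by (auto simp: GL2_orbit_def)
  have inv: "invertible (matrix_inv g)"
    using g(1) by (rule invertible_matrix_inv)
  have A: "A = conj_act m (matrix_inv g) B"
    using g inv assms by (simp add: conj_act_mult matrix_inv_mult conj_act_one)
  show ?thesis
  proof (intro equalityI subsetI)
    fix C assume "C \<in> GL2_orbit m B"
    then obtain h where "invertible h" "C = conj_act m h B"
      by (auto simp: GL2_orbit_def)
    then have "C = conj_act m (h ** g) A" "invertible (h ** g)"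
      using g by (auto simp: conj_act_mult invertible_mult)
    then show "C \<in> GL2_orbit m A"
      unfolding GL2_orbit_def by blast
  next
    fix C assume "C \<in> GL2_orbit m A"
    then obtain h where "invertible h" "C = conj_act m h A"
      by (auto simp: GL2_orbit_def)
    then have "C = conj_act m (h ** matrix_inv g) B" "invertible (h ** matrix_inv g)"
      using inv A by (auto simp: conj_act_mult invertible_mult)
    then show "C \<in> GL2_orbit m B"
      unfolding GL2_orbit_def by blast
  qed
qed

lemma GL2_orbit_refl: "A \<in> nil_tuples m \<Longrightarrow> A \<in> GL2_orbit m A"
  unfolding GL2_orbit_def using conj_act_one[of A m] by (metis (mono_tags, lifting) invertible_def matrix_mul_lid mem_Collect_eq)

lemma GL2_orbit_subset: "A \<in> nil_tuples m \<Longrightarrow> GL2_orbit m A \<subseteq> nil_tuples m"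
  by (auto simp: GL2_orbit_def conj_act_nil_tuples)

lemma invariant_ring_orbit_function:
  fixes \<phi> :: "(nat \<Rightarrow> 'a::{field,finite}^2^2) set \<Rightarrow> 'a"
  shows "(\<lambda>A\<in>nil_tuples m. \<phi> (GL2_orbit m A)) \<in> invariant_ring m"
proof -
  have "\<phi> (GL2_orbit m B) = \<phi> (GL2_orbit m A)" "B \<in> nil_tuples m"
    if "A \<in> nil_tuples m" "B \<in> GL2_orbit m A" for A B
    using GL2_orbit_eq[OF that] GL2_orbit_subset[OF that(1)] that(2) by auto
  then show ?thesis
    by (simp add: invariant_ring_def coord_ring_eq_extensional)
qed

text \<open>Invariants are constant on orbits; conversely the indicator of an orbit is itself an
  invariant.\<close>

lemma invariant_ring_separates:
  fixes A B :: "nat \<Rightarrow> 'a::{field,finite}^2^2"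
  assumes "A \<in> nil_tuples m" "B \<in> nil_tuples m"
  shows "separated_by (invariant_ring m :: ((nat \<Rightarrow> 'a^2^2) \<Rightarrow> 'a) set) A B
     \<longleftrightarrow> GL2_orbit m A \<noteq> GL2_orbit m B"
proof
  assume "separated_by (invariant_ring m :: ((nat \<Rightarrow> 'a^2^2) \<Rightarrow> 'a) set) A B"
  then obtain f :: "(nat \<Rightarrow> 'a^2^2) \<Rightarrow> 'a" where f: "f \<in> invariant_ring m" "f A \<noteq> f B"
    unfolding separated_by_def by blast
  have "f B = f A" if "GL2_orbit m A = GL2_orbit m B"
    using f(1) assms(1) GL2_orbit_refl[OF assms(2)] unfolding that[symmetric] invariant_ring_def by blast
  with f(2) show "GL2_orbit m A \<noteq> GL2_orbit m B"
    by metis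
next
  assume ne: "GL2_orbit m A \<noteq> GL2_orbit m B"
  let ?f = "\<lambda>C\<in>nil_tuples m. if GL2_orbit m C = GL2_orbit m A then 1 else 0 :: 'a"
  have "?f \<in> invariant_ring m"
    by (rule invariant_ring_orbit_function[where \<phi> = "\<lambda>Q. if Q = GL2_orbit m A then 1 else 0"])
  moreover have "?f A \<noteq> ?f B"
    using assms ne by auto
  ultimately show "separated_by (invariant_ring m :: ((nat \<Rightarrow> 'a^2^2) \<Rightarrow> 'a) set) A B"
    unfolding separated_by_def by blast
qed

text \<open>The values of the members of \<open>S\<close> at a representative determine the orbit,
  so orbits inject into the functions from \<open>S\<close> to the field.\<close>

lemma card_GL2_orbits_le_separating:
  fixes S :: "((nat \<Rightarrow> 'a::{field,finite}^2^2) \<Rightarrow> 'a) set"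
  assumes S: "separating_set m S" "finite S"
  shows "card (GL2_orbits m :: (nat \<Rightarrow> 'a^2^2) set set) \<le> CARD('a) ^ card S"
proof -
  let ?O = "GL2_orbits m :: (nat \<Rightarrow> 'a^2^2) set set"
  define rep where "rep Q = (SOME A. A \<in> nil_tuples m \<and> GL2_orbit m A = Q)" for Q :: "(nat \<Rightarrow> 'a^2^2) set"
  have rep: "rep Q \<in> nil_tuples m" "GL2_orbit m (rep Q) = Q" if "Q \<in> ?O" for Q
  proof -
    have "\<exists>A. A \<in> nil_tuples m \<and> GL2_orbit m A = Q"
      using that by (auto simp: GL2_orbits_def)
    from someI_ex[OF this] show "rep Q \<in> nil_tuples m" "GL2_orbit m (rep Q) = Q"
      by (simp_all add: rep_def)
  qed
  have "inj_on (\<lambda>Q. \<lambda>f\<in>S. f (rep Q)) ?O"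
  proof (rule inj_onI, rule ccontr)
    fix Q R assume QR: "Q \<in> ?O" "R \<in> ?O" "Q \<noteq> R"
      and eq: "(\<lambda>f\<in>S. f (rep Q)) = (\<lambda>f\<in>S. f (rep R))"
    have "separated_by (invariant_ring m :: ((nat \<Rightarrow> 'a^2^2) \<Rightarrow> 'a) set) (rep Q) (rep R)"
      using QR rep by (simp add: invariant_ring_separates)
    then have "separated_by S (rep Q) (rep R)"
      using S(1) rep(1)[OF QR(1)] rep(1)[OF QR(2)] unfolding separating_set_def by blast
    then obtain f where "f \<in> S" "f (rep Q) \<noteq> f (rep R)"
      unfolding separated_by_def by blast
    with eq show False
      by (metis restrict_apply')
  qed
  then have "card ?O \<le> card (S \<rightarrow>\<^sub>E (UNIV :: 'a set))"
    by (rule card_inj_on_le) (use S in \<open>auto intro: finite_PiE\<close>)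
  also have "\<dots> = CARD('a) ^ card S"
    using S by (simp add: card_PiE)
  finally show ?thesis .
qed

text \<open>The coordinates of any injection from orbits into n-tuples of scalars are invariants
  that jointly separate. Coordinates may coincide as functions, hence only the bound
  \<open>card S \<le> n\<close>.\<close>

lemma separating_set_exists:
  assumes le: "card (GL2_orbits m :: (nat \<Rightarrow> 'a::{field,finite}^2^2) set set) \<le> CARD('a) ^ n"
  shows "\<exists>S :: ((nat \<Rightarrow> 'a^2^2) \<Rightarrow> 'a) set. separating_set m S \<and> finite S \<and> card S \<le> n"
proof -
  let ?O = "GL2_orbits m :: (nat \<Rightarrow> 'a^2^2) set set"
  have "card ?O \<le> card ({..<n} \<rightarrow>\<^sub>E (UNIV :: 'a set))"
    using le by (simp add: card_PiE)
  moreover have "finite ?O"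
    by (simp add: GL2_orbits_def finite_nil_tuples)
  moreover have "finite ({..<n} \<rightarrow>\<^sub>E (UNIV :: 'a set))"
    by (intro finite_PiE) auto
  ultimately obtain \<phi> where \<phi>: "\<phi> ` ?O \<subseteq> {..<n} \<rightarrow>\<^sub>E (UNIV :: 'a set)" "inj_on \<phi> ?O"
    using card_le_inj by metis
  define f where "f i = (\<lambda>A\<in>nil_tuples m. \<phi> (GL2_orbit m A) i)" for i
  have "separating_set m (f ` {..<n})"
    unfolding separating_set_def
  proof (intro conjI ballI impI)
    show "f ` {..<n} \<subseteq> invariant_ring m"
      by (auto simp: f_def intro: invariant_ring_orbit_function[where \<phi> = "\<lambda>Q. \<phi> Q i" for i])
  next
    fix A B :: "nat \<Rightarrow> 'a^2^2" assume AB: "A \<in> nil_tuples m" "B \<in> nil_tuples m"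
      and "separated_by (invariant_ring m :: ((nat \<Rightarrow> 'a^2^2) \<Rightarrow> 'a) set) A B"
    then have "GL2_orbit m A \<noteq> GL2_orbit m B"
      by (simp add: invariant_ring_separates)
    moreover have O: "GL2_orbit m A \<in> ?O" "GL2_orbit m B \<in> ?O"
      using AB by (auto simp: GL2_orbits_def)
    ultimately have ne: "\<phi> (GL2_orbit m A) \<noteq> \<phi> (GL2_orbit m B)"
      using \<phi>(2) by (auto dest: inj_onD)
    have "\<exists>i<n. \<phi> (GL2_orbit m A) i \<noteq> \<phi> (GL2_orbit m B) i"
    proof (rule ccontr)
      assume "\<not> ?thesis"
      then have "\<phi> (GL2_orbit m A) = \<phi> (GL2_orbit m B)"
        using \<phi>(1) O by (intro PiE_ext[of _ "{..<n}" "\<lambda>_. UNIV"]) auto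
      with ne show False ..
    qed
    then show "separated_by (f ` {..<n}) A B"
      using AB by (auto simp: separated_by_def f_def)
  qed
  moreover have "card (f ` {..<n}) \<le> n"
    using card_image_le[of "{..<n}" f] by simp
  ultimately show ?thesis
    by blast
qed

text \<open>This identifies \<open>\<gamma>\<close> as the least exponent with
  \<open>K \<le> q ^ \<gamma>\<close>. Generically, with X = q^(m-2), the claim is q X^2 < K <= q^2
  X^2, checked after multiplication by q^2 - 1.\<close>

lemma kappa_power_bounds:
  fixes q m K :: nat
  assumes m: "m \<ge> 1" and q: "q \<ge> 2"
    and K: "int K * (int q ^ 2 - 1) = (int q ^ 2 - 1) + (int q ^ m - 1) * (int q ^ (m - 1) + int q)"
    and \<gamma>: "\<gamma> = (if m = 1 then 1 else if m = 2 \<and> q = 2 then 3 else 2 * m - 2)"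
  shows "q ^ (\<gamma> - 1) < K" "K \<le> q ^ \<gamma>"
proof -
  define Q where "Q = int q"
  have Q2: "Q \<ge> 2"
    using q by (simp add: Q_def)
  have "Q * Q \<ge> 2 * Q"
    using Q2 by simp
  then have pos: "Q\<^sup>2 - 1 > 0" and B: "Q * Q - Q - 1 > 0"
    unfolding power2_eq_square using Q2 by linarith+
  have "q ^ (\<gamma> - 1) < K \<and> K \<le> q ^ \<gamma>"
  proof (cases "m = 1")
    case True
    then have "int K * (Q\<^sup>2 - 1) = 2 * (Q\<^sup>2 - 1)"
      using K by (simp add: Q_def algebra_simps power2_eq_square)
    moreover have "Q\<^sup>2 - 1 \<noteq> 0"
      using pos by simp
    ultimately have "int K = 2"
      using mult_right_cancel by blast
    then show ?thesis
      using True \<gamma> q by simp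
  next
    case False
    define n where "n = m - 2"
    have n: "m = Suc (Suc n)"
      using m \<open>m \<noteq> 1\<close> by (simp add: n_def)
    show ?thesis
    proof (cases "m = 2 \<and> q = 2")
      case True
      \<comment> \<open>Five orbits exceed 2^2, so the generic exponent 2m - 2 = 2 fails here and 3
        is needed.\<close>
      then have "K = 5"
        using K by simp
      then show ?thesis
        using True \<gamma> by simp
    next
      case False
      define X where "X = Q ^ n"
      have X1: "X \<ge> 1"
        using Q2 by (simp add: X_def)
      have \<gamma>n: "\<gamma> = 2 * n + 2"
        using False \<gamma> n by auto
      have K': "int K * (Q\<^sup>2 - 1) = (Q\<^sup>2 - 1) + (Q * Q * X - 1) * (Q * X + Q)"
        using K by (simp add: n Q_def X_def)
      have pow: "int (q ^ (\<gamma> - 1)) = Q * X * X" "int (q ^ \<gamma>) = Q * Q * X * X"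
        by (simp_all add: \<gamma>n Q_def X_def power_add mult_2)
      have XX: "X * X \<ge> X"
        using X1 by simp
      have "Q * X * X * (Q\<^sup>2 - 1) < int K * (Q\<^sup>2 - 1)"
      proof -
        \<comment> \<open>This is the right-hand side minus the left-hand side, after expanding
          \<open>K'\<close>.\<close>
        have "0 < Q * (X * X) + X * (Q * (Q\<^sup>2 - 1)) + (Q * Q - Q - 1)"
          using X1 Q2 pos B by (intro add_pos_pos) auto
        then show ?thesis
          unfolding K' by (simp add: algebra_simps power2_eq_square)
      qed
      then have low: "Q * X * X < int K"
        using pos by simp
      \<comment> \<open>The upper bound times \<open>Q\<^sup>2 - 1\<close>, with the common term Q^3
        X^2 cancelled. For \<open>Q = 2\<close> it fails at \<open>X = 1\<close>, which is the
        excluded case m = q = 2, so there \<open>X \<ge> 2\<close> is used; for larger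
        \<open>Q\<close> it holds from \<open>X = 1\<close> on.\<close>
      have "X * (Q * (Q\<^sup>2 - 1)) + (Q * Q - Q - 1) \<le> (X * X) * (Q * Q * (Q * Q - Q - 1))"
      proof (cases "Q = 2")
        case True
        then have "n \<noteq> 0"
          using False n by (auto simp: Q_def)
        then have "X \<ge> 2"
          using True by (simp add: X_def self_le_power)
        then have "X * X \<ge> 2 * X"
          by simp
        then have "X * 6 + 1 \<le> X * X * 4"
          using \<open>X \<ge> 2\<close> by linarith
        then show ?thesis
          by (simp add: True)
      next
        case False
        then have Q3: "Q \<ge> 3"
          using Q2 by simp
        have "Q * Q \<ge> 3 * Q"
          using Q3 by simp
        then have "2 * Q \<le> Q\<^sup>2 - 1"
          unfolding power2_eq_square using Q3 by linarith
        \<comment> \<open>This rearranges to the case \<open>X = 1\<close>, whose two sides differ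
          by (Q^2 - 1)(Q^2 - 1 - 2Q). General \<open>X\<close> follows by scaling with X^2 and using
          X <= X^2.\<close>
        then have "(Q\<^sup>2 - 1) * (2 * Q) \<le> (Q\<^sup>2 - 1) * (Q\<^sup>2 - 1)"
          using pos by (intro mult_left_mono) auto
        then have "Q * (Q\<^sup>2 - 1) + (Q * Q - Q - 1) \<le> Q * Q * (Q * Q - Q - 1)"
          by (simp add: algebra_simps power2_eq_square)
        then have "(X * X) * (Q * (Q\<^sup>2 - 1) + (Q * Q - Q - 1)) \<le> (X * X) * (Q * Q * (Q * Q - Q - 1))"
          using X1 by (intro mult_left_mono) auto
        moreover have "X * (Q * (Q\<^sup>2 - 1)) \<le> (X * X) * (Q * (Q\<^sup>2 - 1))"
          using XX pos Q2 by (intro mult_right_mono) auto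
        moreover have "1 * (Q * Q - Q - 1) \<le> (X * X) * (Q * Q - Q - 1)"
          by (intro mult_right_mono) (use XX X1 B in linarith)+
        ultimately show ?thesis
          by (simp add: algebra_simps)
      qed
      then have "int K * (Q\<^sup>2 - 1) \<le> Q * Q * X * X * (Q\<^sup>2 - 1)"
        unfolding K' by (simp add: algebra_simps power2_eq_square)
      then have "int K \<le> Q * Q * X * X"
        using pos by simp
      with low show ?thesis
        by (metis pow of_nat_le_iff of_nat_less_iff)
    qed
  qed
  then show "q ^ (\<gamma> - 1) < K" "K \<le> q ^ \<gamma>"
    by auto
qed

section \<open>Orbit count, its polynomial form and the least separating set combined\<close>

theorem corollary3p5:
  fixes m q :: nat and \<kappa> :: real and \<gamma> :: nat
  assumes m: "m \<ge> 1"
    and q: "q = CARD('a::{field,finite})"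
    and kappa: "\<kappa> = 1 + ((real q ^ m - 1) * (real q ^ (m - 1) + real q)) / (real q ^ 2 - 1)"
    and gamma: "\<gamma> = (if m = 1 then 1 else if m = 2 \<and> q = 2 then 3 else 2 * m - 2)"
  shows "real (card (GL2_orbits m :: (nat \<Rightarrow> 'a^2^2) set set)) = \<kappa>
    \<and> (\<kappa> = kappa_expr m (real q)
        \<and> \<kappa> = real_of_int (poly (kappa_expr m [:0, 1:]) (int q))
        \<and> (\<forall>i. coeff (kappa_expr m [:0, 1:] :: int poly) i \<ge> 0))
    \<and> ((\<exists>S :: ((nat \<Rightarrow> 'a^2^2) \<Rightarrow> 'a) set. separating_set m S \<and> finite S \<and> card S = \<gamma>)
        \<and> (\<forall>S :: ((nat \<Rightarrow> 'a^2^2) \<Rightarrow> 'a) set. separating_set m S \<and> finite S \<longrightarrow> \<gamma> \<le> card S))"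
proof -
  let ?K = "card (GL2_orbits m :: (nat \<Rightarrow> 'a^2^2) set set)"
  have "CARD('a) \<ge> card {0, 1 :: 'a}"
    by (rule card_mono) auto
  then have q2: "q \<ge> 2"
    by (simp add: q)
  have K: "int ?K * (int q ^ 2 - 1) = (int q ^ 2 - 1) + (int q ^ m - 1) * (int q ^ (m - 1) + int q)"
    unfolding q by (rule card_GL2_orbits[OF m])
  have "real q ^ 2 > 1"
    using q2 by (simp add: one_less_power)
  then have nz: "real q ^ 2 - 1 \<noteq> 0"
    by simp
  have "real_of_int (int ?K * (int q ^ 2 - 1))
      = real_of_int ((int q ^ 2 - 1) + (int q ^ m - 1) * (int q ^ (m - 1) + int q))"
    by (simp only: K)
  then have "real ?K = \<kappa>"
    using nz by (simp add: kappa field_simps)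
  moreover have kap: "\<kappa> = kappa_expr m (real q)"
    using kappa_expr_mult[OF m, of "real q"] nz by (simp add: kappa field_simps)
  moreover have "\<kappa> = real_of_int (poly (kappa_expr m [:0, 1:]) (int q))"
    by (simp add: poly_kappa_expr of_int_kappa_expr kap)
  moreover have low: "\<gamma> \<le> card S" if "separating_set m S" "finite S" for S :: "((nat \<Rightarrow> 'a^2^2) \<Rightarrow> 'a) set"
  proof -
    \<comment> \<open>The orbit count lies strictly above the left side and is at most the right
      side.\<close>
    have "q ^ (\<gamma> - 1) < q ^ card S"
      using kappa_power_bounds(1)[OF m q2 K gamma] card_GL2_orbits_le_separating[OF that] q by simp
    then show ?thesis
      using q2 by (simp add: power_strict_increasing_iff)
  qed
  \<comment> \<open>The construction yields at most \<open>\<gamma>\<close> elements; the lower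
    bound \<open>low\<close> forces equality.\<close>
  moreover have "\<exists>S :: ((nat \<Rightarrow> 'a^2^2) \<Rightarrow> 'a) set. separating_set m S \<and> finite S \<and> card S = \<gamma>"
    using separating_set_exists[of m \<gamma>] kappa_power_bounds(2)[OF m q2 K gamma] low q by (metis le_antisym)
  ultimately show ?thesis
    using coeff_kappa_expr_nonneg[of m] by blast
qed

end
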